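(* Let $s\in(0,1)$. Suppose that $Q = I_N$ and $B = O_N$ (the identity and the zero $N\times N$ matrices), so that $\mathscr K = \Delta - \partial_t$ on $\mathbb R^{N+1}$, and let $u(X,t) = v(X)$ for a measurable function $v:\mathbb R^N\to\mathbb R$. Then, for every $(X,t)\in\mathbb R^{N+1}$, $$\Gamma^{\mathscr K}_{(s)}(u)(X,t) = \Gamma_{(s)}(v)(X) = \frac{\gamma(N,s)}{2} \int_{\mathbb R^N} \frac{(v(X) - v(Y))^2}{|X-Y|^{N + 2s}}\, dY.$$
   Context: $N\ge 2$; points of $\mathbb R^{N+1}$ are written $(X,t)$ with $X\in\mathbb R^N$, $t\in\mathbb R$. Given real constant $N\times N$ matrices $Q=Q^\star\ge 0$ and $B$, let $$\mathscr K u = \operatorname{tr}(Q \nabla^2 u) + \langle BX,\nabla u\rangle - \partial_t u ,\qquad K(t) = \frac 1t \int_0^t e^{\sigma B} Q e^{\sigma B^\star} d\sigma ,$$ where $\nabla,\nabla^2$ are taken in $X$, and $K(t)>0$ is assumed for every $t>0$. Let $$p(X,Y,t) = (4\pi)^{- \frac N2} \left(\det(t K(t))\right)^{-1/2} \exp\left( - \frac{\langle K(t)^{-1}(Y-e^{tB} X ),Y-e^{tB} X \rangle}{4t}\right)$$ for $X,Y\in\mathbb R^N$, $t>0$, and $$P_\tau^{\mathscr K} u(X,t) = \int_{\mathbb R^N} p(X,Y,\tau)\, u(Y,t-\tau)\, dY,\qquad \tau>0.$$ For $s\in(0,1)$ the nonlocal evolutive carré du champ of a function $u:\mathbb R^{N+1}\to\mathbb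 R$ is $$\Gamma^{\mathscr K}_{(s)}(u)(X,t) = \frac{s}{2\Gamma(1-s)}\int_0^\infty \frac{1}{\tau^{1+s}}\, P^{\mathscr K}_\tau\big((u - u(X,t))^2\big)(X,t)\, d\tau,$$ i.e. $P^{\mathscr K}_\tau((u - u(X,t))^2)(X,t)=\int_{\mathbb R^N}p(X,Y,\tau)\,(u(Y,t-\tau)-u(X,t))^2\,dY$. These nonnegative integrals take values in $[0,\infty]$. Here $\Gamma(\cdot)$ with a numerical argument is the Euler gamma function. Finally, $\Gamma_{(s)}(v)(X)$ denotes $\frac{\gamma(N,s)}{2} \int_{\mathbb R^N} \frac{(v(X) - v(Y))^2}{|X-Y|^{N + 2s}}\, dY$, where $$\gamma(N,s) = \frac{s 2^{2s} \Gamma\left(\frac{N+ 2s}{2}\right)}{\pi^{\frac N2} \Gamma(1-s)}.$$ *)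

theory Defs
  imports "HOL-Analysis.Analysis"
begin

text \<open>
  The gradient, Hessian and Laplacian act on the \<open>X\<close> variable only; points of \<open>\<real>\<^sup>N\<^sup>+\<^sup>1\<close> are pairs \<open>(X, t)\<close> of type \<open>(real ^ 'n) \<times> real\<close>, with \<open>N = CARD('n)\<close>.
\<close>

definition partial_X :: "'n::finite \<Rightarrow> ((real ^ 'n) \<times> real \<Rightarrow> real) \<Rightarrow> (real ^ 'n) \<times> real \<Rightarrow> real" where
  "partial_X i w = (\<lambda>(X, t). deriv (\<lambda>h. w (X + h *\<^sub>R axis i 1, t)) 0)"

definition partial_t :: "((real ^ 'n::finite) \<times> real \<Rightarrow> real) \<Rightarrow> (real ^ 'n) \<times> real \<Rightarrow> real" where
  "partial_t w = (\<lambda>(X, t). deriv (\<lambda>r. w (X, r)) t)"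

definition grad_X :: "((real ^ 'n::finite) \<times> real \<Rightarrow> real) \<Rightarrow> (real ^ 'n) \<times> real \<Rightarrow> real ^ 'n" where
  "grad_X w z = (\<chi> i. partial_X i w z)"

definition hess_X :: "((real ^ 'n::finite) \<times> real \<Rightarrow> real) \<Rightarrow> (real ^ 'n) \<times> real \<Rightarrow> real ^ 'n ^ 'n" where
  "hess_X w z = (\<chi> i j. partial_X i (partial_X j w) z)"

definition laplacian_X :: "((real ^ 'n::finite) \<times> real \<Rightarrow> real) \<Rightarrow> (real ^ 'n) \<times> real \<Rightarrow> real" where
  "laplacian_X w z = (\<Sum>i\<in>UNIV. partial_X i (partial_X i w) z)"

definition K_op :: "real ^ 'n ^ 'n \<Rightarrow> real ^ 'n ^ 'n \<Rightarrow>
    ((real ^ 'n::finite) \<times> real \<Rightarrow> real) \<Rightarrow> (real ^ 'n) \<times> real \<Rightarrow> real" where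
  "K_op Q B w = (\<lambda>(X, t).
     trace (Q ** hess_X w (X, t)) + (B *v X) \<bullet> grad_X w (X, t) - partial_t w (X, t))"

text \<open>
  The library function \<^const>\<open>exp\<close> is not available on \<^typ>\<open>real ^ 'n ^ 'n\<close>, and the
  operations \<open>*\<close> and \<open>^\<close> on that type act componentwise; matrix powers and the exponential
  series are therefore built from the matrix product \<open>**\<close>.
\<close>

primrec mat_pow :: "real ^ 'n ^ 'n \<Rightarrow> nat \<Rightarrow> real ^ 'n ^ 'n::finite" where
  "mat_pow A 0 = mat 1"
| "mat_pow A (Suc k) = A ** mat_pow A k"

definition mat_exp :: "real ^ 'n ^ 'n \<Rightarrow> real ^ 'n ^ 'n::finite" where
  "mat_exp A = (\<Sum>k. (1 / fact k) *\<^sub>R mat_pow A k)"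

definition K_mat :: "real ^ 'n ^ 'n \<Rightarrow> real ^ 'n ^ 'n \<Rightarrow> real \<Rightarrow> real ^ 'n ^ 'n::finite" where
  "K_mat Q B t = (1 / t) *\<^sub>R
     integral {0..t} (\<lambda>\<sigma>. mat_exp (\<sigma> *\<^sub>R B) ** Q ** mat_exp (\<sigma> *\<^sub>R transpose B))"

definition p_kernel :: "real ^ 'n ^ 'n \<Rightarrow> real ^ 'n ^ 'n \<Rightarrow>
    real ^ 'n \<Rightarrow> real ^ 'n \<Rightarrow> real \<Rightarrow> real" where
  "p_kernel Q B X Y t =
     (4 * pi) powr (- (real CARD('n) / 2)) * det (t *\<^sub>R K_mat Q B t) powr (- (1 / 2)) *
     exp (- (((matrix_inv (K_mat Q B t) *v (Y - mat_exp (t *\<^sub>R B) *v X))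
               \<bullet> (Y - mat_exp (t *\<^sub>R B) *v X)) / (4 * t)))"

text \<open>
  The semigroup acts here on \<open>[0, \<infinity>]\<close>-valued functions; this is the only case the
  carre du champ requires, and the integral is then always meaningful.
\<close>

definition P_semigroup :: "real ^ 'n ^ 'n \<Rightarrow> real ^ 'n ^ 'n \<Rightarrow> real \<Rightarrow>
    ((real ^ 'n) \<times> real \<Rightarrow> ennreal) \<Rightarrow> (real ^ 'n) \<times> real \<Rightarrow> ennreal" where
  "P_semigroup Q B \<tau> f = (\<lambda>(X, t).
     \<integral>\<^sup>+ Y. ennreal (p_kernel Q B X Y \<tau>) * f (Y, t - \<tau>) \<partial>lebesgue)"

definition carre_evol :: "real ^ 'n ^ 'n \<Rightarrow> real ^ 'n ^ 'n \<Rightarrow> real \<Rightarrow>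
    ((real ^ 'n) \<times> real \<Rightarrow> real) \<Rightarrow> (real ^ 'n) \<times> real \<Rightarrow> ennreal" where
  "carre_evol Q B s u z =
     ennreal (s / (2 * Gamma (1 - s))) *
     (\<integral>\<^sup>+ \<tau>\<in>{0<..}. ennreal (1 / \<tau> powr (1 + s)) *
        P_semigroup Q B \<tau> (\<lambda>y. ennreal ((u y - u z)\<^sup>2)) z \<partial>lebesgue)"

definition gamma_const :: "nat \<Rightarrow> real \<Rightarrow> real" where
  "gamma_const N s =
     s * 2 powr (2 * s) * Gamma ((real N + 2 * s) / 2) / (pi powr (real N / 2) * Gamma (1 - s))"

definition carre :: "real \<Rightarrow> (real ^ 'n \<Rightarrow> real) \<Rightarrow> real ^ 'n \<Rightarrow> ennreal" where
  "carre s v X =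
     ennreal (gamma_const CARD('n) s / 2) *
     (\<integral>\<^sup>+ Y. ennreal ((v X - v Y)\<^sup>2 / norm (X - Y) powr (real CARD('n) + 2 * s)) \<partial>lebesgue)"

end

theory Submission
  imports Defs
begin

text \<open>
  For \<open>Q = I\<close> and \<open>B = 0\<close> the kernel \<open>p\<close> is the Gauss--Weierstrass kernel.  Since \<open>u\<close> does not depend
  on time, Tonelli's theorem reduces the claim to the subordination identity
  \<open>\<integral>\<^sub>0\<^sup>\<infinity> \<tau>\<^sup>-\<^sup>1\<^sup>-\<^sup>s p(X,Y,\<tau>) d\<tau> = C \<bar>X - Y\<bar>\<^sup>-\<^sup>N\<^sup>-\<^sup>2\<^sup>s\<close> for \<open>Y \<noteq> X\<close>, which is Euler's integral for
  \<open>\<Gamma>(N/2 + s)\<close> after the substitution \<open>\<tau> = \<bar>X - Y\<bar>\<^sup>2 / (4x)\<close>.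
\<close>

lemma mat_pow_zero: "mat_pow 0 k = (if k = 0 then mat 1 else 0)"
  by (cases k) (auto simp: matrix_matrix_mult_def zero_vec_def)

lemma mat_exp_zero: "mat_exp (0 :: real ^ 'n ^ 'n) = mat 1"
proof -
  have "mat_exp (0 :: real ^ 'n ^ 'n) = (\<Sum>k\<in>{0}. (1 / fact k) *\<^sub>R mat_pow 0 k)"
    unfolding mat_exp_def by (rule suminf_finite) (auto simp: mat_pow_zero)
  then show ?thesis
    by simp
qed

lemma matrix_inv_mat_1: "matrix_inv (mat 1 :: real ^ 'n ^ 'n) = mat 1"
proof -
  have "mat 1 ** matrix_inv (mat 1 :: real ^ 'n ^ 'n) = mat 1 \<and>
        matrix_inv (mat 1 :: real ^ 'n ^ 'n) ** mat 1 = mat 1"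
    unfolding matrix_inv_def by (rule someI[where x = "mat 1"]) simp
  then show ?thesis
    by simp
qed

text \<open>Both exponentials are the identity, so the integrand is constantly \<open>mat 1\<close>;
  integrating over \<open>{0..t}\<close> gives \<open>t\<close> times the identity, and the
  prefactor \<open>1 / t\<close> cancels.\<close>

lemma K_mat_heat:
  assumes "t > 0"
  shows "K_mat (mat 1) 0 t = (mat 1 :: real ^ 'n ^ 'n)"
proof -
  have [simp]: "transpose (0 :: real ^ 'n ^ 'n) = 0"
    by (simp add: transpose_def vec_eq_iff)
  show ?thesis
    using assms by (simp add: K_mat_def mat_exp_zero)
qed

lemma det_scaleR_mat_1: "det (t *\<^sub>R (mat 1 :: real ^ 'n ^ 'n)) = t ^ CARD('n)"
  by (subst det_diagonal) (auto simp: mat_def)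

text \<open>The exponent is grouped as \<open>/ 4 / t\<close> so that it has the form
  \<open>b / t\<close>, with b independent of time, as in the Gamma integral below.\<close>

lemma p_kernel_heat:
  fixes X Y :: "real ^ 'n"
  assumes "t > 0"
  shows "p_kernel (mat 1) 0 X Y t =
    (4 * pi * t) powr (- (real CARD('n) / 2)) * exp (- ((norm (X - Y))\<^sup>2 / 4 / t))"
proof -
  have "(t ^ CARD('n)) powr (- (1 / 2)) = t powr (- (real CARD('n) / 2))"
    using assms by (simp add: powr_powr flip: powr_realpow)
  moreover have "(Y - X) \<bullet> (Y - X) = (norm (X - Y))\<^sup>2"
    by (metis norm_minus_commute power2_norm_eq_inner)
  ultimately show ?thesis
    using assms
    by (simp add: p_kernel_def K_mat_heat mat_exp_zero matrix_inv_mat_1 det_scaleR_mat_1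
        powr_mult)
qed

lemma trace_hess_X: "trace (hess_X w z) = laplacian_X w z"
  by (simp add: trace_def hess_X_def laplacian_X_def)

lemma K_op_heat: "K_op (mat 1) 0 w = (\<lambda>z. laplacian_X w z - partial_t w z)"
  by (auto simp: K_op_def trace_hess_X fun_eq_iff)

text \<open>Euler's integral for \<open>Gamma a\<close> turns into this one under \<tau> = b / x,
  whose derivative is \<open>- b / x\<^sup>2\<close>.\<close>

lemma has_integral_inverse_Gamma:
  fixes a b :: real
  assumes "a > 0" "b > 0"
  shows "((\<lambda>\<tau>. \<tau> powr (- 1 - a) * exp (- (b / \<tau>))) has_integral (Gamma a / b powr a)) {0<..}"
proof -
  define f where "f = (\<lambda>\<tau>::real. \<tau> powr (- 1 - a) * exp (- (b / \<tau>)))"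
  \<comment> \<open>Euler's integral is available over \<open>{0..}\<close>; the null set
    \<open>{0}\<close> is dropped because x \<mapsto> b / x is a bijection of the open half-line
    only.\<close>
  have "((\<lambda>x. x powr (a - 1) / exp x) has_integral Gamma a) {0<..}"
  proof -
    have "((\<lambda>x. if x \<in> {0<..} then x powr (a - 1) / exp x else 0) has_integral Gamma a) {0..}"
      by (rule has_integral_spike[OF _ _ Gamma_integral_real[OF assms(1)], of "{0}"]) auto
    then show ?thesis
      by (subst (asm) has_integral_restrict) auto
  qed
  then have "((\<lambda>x. (x powr (a - 1) / exp x) / b powr a) has_integral (Gamma a / b powr a)) {0<..}"
    by (rule has_integral_divide)
  moreover have subst: "\<bar>- b / x\<^sup>2\<bar> * f (b / x) = (x powr (a - 1) / exp x) / b powr a"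
    if "x \<in> {0<..}" for x
  proof -
    have "b powr (1 + a) = b * b powr a" "x powr (1 + a) = x\<^sup>2 * x powr (a - 1)"
      using assms that by (simp_all add: powr_add powr_diff power2_eq_square)
    moreover have "(b / x) powr (- 1 - a) = x powr (1 + a) / b powr (1 + a)"
      using assms that powr_minus[of "b / x" "1 + a"] by (simp add: powr_divide)
    ultimately show ?thesis
      using assms that by (simp add: f_def exp_minus field_simps)
  qed
  ultimately have int: "((\<lambda>x. \<bar>- b / x\<^sup>2\<bar> * f (b / x)) has_integral (Gamma a / b powr a)) {0<..}"
    by (subst has_integral_cong[OF subst])
  \<comment> \<open>The change of variables is stated for absolute integrals; nonnegativity of the
    integrand supplies this.\<close>
  moreover have "(\<lambda>x. \<bar>- b / x\<^sup>2\<bar> * f (b / x)) absolutely_integrable_on {0<..}"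
    by (rule nonnegative_absolutely_integrable_1) (use int in \<open>auto simp: f_def\<close>)
  moreover have "(\<lambda>x. b / x) ` {0<..} = {0<..}"
  proof (intro equalityI subsetI)
    fix y :: real assume "y \<in> {0<..}"
    then show "y \<in> (\<lambda>x. b / x) ` {0<..}"
      using assms by (intro image_eqI[of _ _ "b / y"]) auto
  qed (use assms in auto)
  moreover have "((\<lambda>x. b / x) has_field_derivative - b / x\<^sup>2) (at x within {0<..})"
    if "x \<in> {0<..}" for x
    using that by (auto intro!: derivative_eq_intros simp: power2_eq_square)
  moreover have "inj_on (\<lambda>x. b / x) {0<..}"
    using assms by (auto simp: inj_on_def)
  ultimately have "f absolutely_integrable_on {0<..} \<and> integral {0<..} f = Gamma a / b powr a"
    using has_absolute_integral_change_of_variables_1'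
      [of "{0<..}" "\<lambda>x. b / x" "\<lambda>x. - b / x\<^sup>2" f "Gamma a / b powr a"]
    by (auto simp: integral_unique)
  then show ?thesis
    unfolding f_def[symmetric]
    by (auto simp: has_integral_integrable_integral set_lebesgue_integral_eq_integral(1))
qed

text \<open>The kernel contributes \<tau> to the power -N/2 and the weight the power -1-s, together
  -1-a. The assumption \<open>Y \<noteq> X\<close> makes b = |X-Y|^2 / 4 positive, as the inverse
  Gamma integral requires.\<close>

lemma nn_integral_subordinated_heat_kernel:
  fixes X Y :: "real ^ 'n"
  assumes "s > 0" "Y \<noteq> X"
  defines "a \<equiv> real CARD('n) / 2 + s"
  shows "(\<integral>\<^sup>+ \<tau>\<in>{0<..}. ennreal (1 / \<tau> powr (1 + s)) * ennreal (p_kernel (mat 1) 0 X Y \<tau>) \<partial>lborel) =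
    ennreal (2 powr (2 * s) * Gamma a / pi powr (real CARD('n) / 2)
      / norm (X - Y) powr (real CARD('n) + 2 * s))"
proof -
  define b where "b = (norm (X - Y))\<^sup>2 / 4"
  define c where "c = (4 * pi) powr (- (real CARD('n) / 2))"
  have a: "a > 0" and b: "b > 0"
    using assms by (auto simp: a_def b_def add_nonneg_pos)
  have kernel: "ennreal (1 / \<tau> powr (1 + s)) * ennreal (p_kernel (mat 1) 0 X Y \<tau>) =
      ennreal (c * (\<tau> powr (- 1 - a) * exp (- (b / \<tau>))))" if "\<tau> > 0" for \<tau>
  proof -
    have "1 / \<tau> powr (1 + s) * \<tau> powr (- (real CARD('n) / 2)) =
        \<tau> powr (- (1 + s) + - (real CARD('n) / 2))"
      by (simp only: powr_add powr_minus_divide)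
    also have "- (1 + s) + - (real CARD('n) / 2) = - 1 - a"
      by (simp add: a_def)
    finally have "\<tau> powr (- 1 - a) = \<tau> powr (- (real CARD('n) / 2)) / \<tau> powr (1 + s)"
      by simp
    then show ?thesis
      using that
      by (simp add: p_kernel_heat powr_mult c_def b_def mult_ac flip: ennreal_mult')
  qed
  have "(\<integral>\<^sup>+ \<tau>\<in>{0<..}. ennreal (1 / \<tau> powr (1 + s)) * ennreal (p_kernel (mat 1) 0 X Y \<tau>) \<partial>lborel) =
      (\<integral>\<^sup>+ \<tau>\<in>{0<..}. ennreal (c * (\<tau> powr (- 1 - a) * exp (- (b / \<tau>)))) \<partial>lborel)"
    by (intro nn_integral_cong) (auto simp: kernel split: split_indicator)
  also have "\<dots> = ennreal (c * (Gamma a / b powr a))"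
    by (intro nn_integral_has_integral_lebesgue' has_integral_mult_right
        has_integral_inverse_Gamma a b) (simp add: c_def)
  also have "c * (Gamma a / b powr a) = 2 powr (2 * s) * Gamma a / pi powr (real CARD('n) / 2)
      / norm (X - Y) powr (real CARD('n) + 2 * s)"
  proof -
    \<comment> \<open>The factor 4 to the power a coming from b splits into 4^(N/2), which cancels
      against the prefactor \<open>c\<close>, and 2^(2s), which survives in the constant.\<close>
    have "b powr a = norm (X - Y) powr (real CARD('n) + 2 * s) / 4 powr a"
      using assms powr_powr[of "norm (X - Y)" 2 a]
      by (simp add: b_def a_def powr_divide algebra_simps)
    moreover have "(4::real) powr a = 4 powr (real CARD('n) / 2) * 2 powr (2 * s)"
      using powr_powr[of 2 2 s] by (simp add: a_def powr_add)
    ultimately have "norm (X - Y) powr (real CARD('n) + 2 * s) =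
        b powr a * (4 powr (real CARD('n) / 2) * 2 powr (2 * s))"
      by simp
    then show ?thesis
      by (simp only:) (simp add: c_def powr_minus powr_mult field_simps)
  qed
  finally show ?thesis .
qed

text \<open>The constant \<open>c\<close> stands for the value of the original function at X. It is
  kept apart from \<open>v\<close> because \<open>v\<close> will be instantiated with a Borel
  representative, which may take another value at X.\<close>

lemma carre_evol_heat_borel:
  fixes v :: "real ^ 'n \<Rightarrow> real"
  assumes s: "0 < s" "s < 1"
    and [measurable]: "v \<in> borel_measurable borel"
  shows "ennreal (s / (2 * Gamma (1 - s))) * (\<integral>\<^sup>+ \<tau>\<in>{0<..}. ennreal (1 / \<tau> powr (1 + s)) *
      (\<integral>\<^sup>+ Y. ennreal (p_kernel (mat 1) 0 X Y \<tau>) * ennreal ((v Y - c)\<^sup>2) \<partial>lborel) \<partial>lborel) =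
    ennreal (gamma_const CARD('n) s / 2) *
      (\<integral>\<^sup>+ Y. ennreal ((c - v Y)\<^sup>2 / norm (X - Y) powr (real CARD('n) + 2 * s)) \<partial>lborel)"
    (is "ennreal ?A * ?L = _")
proof -
  \<comment> \<open>The explicit formula makes joint measurability in (\<tau>, Y) evident; it is
    identified with \<open>p_kernel\<close> only for \<tau> > 0, where the indicator lives.\<close>
  define h where "h = (\<lambda>(\<tau>::real) Y. (4 * pi * \<tau>) powr (- (real CARD('n) / 2))
    * exp (- ((norm (X - Y))\<^sup>2 / 4 / \<tau>)))"
  define C where "C = 2 powr (2 * s) * Gamma (real CARD('n) / 2 + s) / pi powr (real CARD('n) / 2)"
  have h_kernel: "h \<tau> Y = p_kernel (mat 1) 0 X Y \<tau>" if "\<tau> > 0" for \<tau> Y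
    using that by (simp add: h_def p_kernel_heat)
  have h_meas [measurable]: "case_prod h \<in> borel_measurable (lborel \<Otimes>\<^sub>M lborel)"
    unfolding h_def by measurable
  have h_meas2 [measurable]: "h \<tau> \<in> borel_measurable lborel" for \<tau>
    unfolding h_def by measurable
  have h_meas1 [measurable]: "(\<lambda>\<tau>. h \<tau> Y) \<in> borel_measurable lborel" for Y
    unfolding h_def by measurable
  have C: "C \<ge> 0"
    using s by (auto simp: C_def intro!: mult_nonneg_nonneg divide_nonneg_nonneg less_imp_le Gamma_real_pos
        add_nonneg_pos)
  \<comment> \<open>Weight and indicator move under the inner integral, so that Tonelli applies over
    the whole product space.\<close>
  have "?L = (\<integral>\<^sup>+ \<tau>. (\<integral>\<^sup>+ Y. ennreal (1 / \<tau> powr (1 + s)) * indicator {0<..} \<tau> *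
      (ennreal (h \<tau> Y) * ennreal ((v Y - c)\<^sup>2)) \<partial>lborel) \<partial>lborel)"
    by (intro nn_integral_cong, subst nn_integral_cmult)
      (auto simp: h_kernel mult_ac split: split_indicator)
  also have "\<dots> = (\<integral>\<^sup>+ Y. (\<integral>\<^sup>+ \<tau>. ennreal (1 / \<tau> powr (1 + s)) * indicator {0<..} \<tau> *
      (ennreal (h \<tau> Y) * ennreal ((v Y - c)\<^sup>2)) \<partial>lborel) \<partial>lborel)"
    by (rule lborel_pair.Fubini'[symmetric]) (measurable; simp)
  also have "\<dots> = (\<integral>\<^sup>+ Y. ennreal C *
      ennreal ((c - v Y)\<^sup>2 / norm (X - Y) powr (real CARD('n) + 2 * s)) \<partial>lborel)"
  proof (rule nn_integral_cong_AE)
    \<comment> \<open>The point Y = X has to be discarded: there the right side is 0 by division by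
      zero, while the left side is infinite if v X differs from c.\<close>
    have "AE Y in lborel. Y \<noteq> X"
      by (rule AE_lborel_singleton)
    then show "AE Y in lborel. (\<integral>\<^sup>+ \<tau>. ennreal (1 / \<tau> powr (1 + s)) * indicator {0<..} \<tau> *
      (ennreal (h \<tau> Y) * ennreal ((v Y - c)\<^sup>2)) \<partial>lborel) =
      ennreal C * ennreal ((c - v Y)\<^sup>2 / norm (X - Y) powr (real CARD('n) + 2 * s))"
    proof eventually_elim
      case (elim Y)
      have "(\<integral>\<^sup>+ \<tau>. ennreal (1 / \<tau> powr (1 + s)) * indicator {0<..} \<tau> *
          (ennreal (h \<tau> Y) * ennreal ((v Y - c)\<^sup>2)) \<partial>lborel) =
        (\<integral>\<^sup>+ \<tau>. ennreal ((v Y - c)\<^sup>2) * (ennreal (1 / \<tau> powr (1 + s)) * ennreal (h \<tau> Y)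
          * indicator {0<..} \<tau>) \<partial>lborel)"
        by (simp add: mult_ac)
      also have "\<dots> = ennreal ((v Y - c)\<^sup>2) * (\<integral>\<^sup>+ \<tau>\<in>{0<..}. ennreal (1 / \<tau> powr (1 + s)) *
          ennreal (h \<tau> Y) \<partial>lborel)"
        by (rule nn_integral_cmult) measurable
      also have "(\<integral>\<^sup>+ \<tau>\<in>{0<..}. ennreal (1 / \<tau> powr (1 + s)) * ennreal (h \<tau> Y) \<partial>lborel) =
          (\<integral>\<^sup>+ \<tau>\<in>{0<..}. ennreal (1 / \<tau> powr (1 + s)) * ennreal (p_kernel (mat 1) 0 X Y \<tau>) \<partial>lborel)"
        by (intro nn_integral_cong) (auto simp: h_kernel split: split_indicator)
      also have "\<dots> = ennreal (C / norm (X - Y) powr (real CARD('n) + 2 * s))"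
        using nn_integral_subordinated_heat_kernel[OF s(1) elim] by (simp add: C_def)
      finally show ?case
        using C by (simp add: power2_commute mult_ac flip: ennreal_mult')
    qed
  qed
  also have "\<dots> = ennreal C *
      (\<integral>\<^sup>+ Y. ennreal ((c - v Y)\<^sup>2 / norm (X - Y) powr (real CARD('n) + 2 * s)) \<partial>lborel)"
    by (rule nn_integral_cmult) measurable
  also have "ennreal ?A * \<dots> = ennreal (?A * C) *
      (\<integral>\<^sup>+ Y. ennreal ((c - v Y)\<^sup>2 / norm (X - Y) powr (real CARD('n) + 2 * s)) \<partial>lborel)"
    unfolding ennreal_mult''[OF C] by (simp only: mult.assoc)
  also have "?A * C = gamma_const CARD('n) s / 2"
    by (simp add: C_def gamma_const_def add_divide_distrib mult_ac)
  finally show ?thesis .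
qed

lemma carre_evol_heat:
  fixes v :: "real ^ 'n \<Rightarrow> real"
  assumes s: "0 < s" "s < 1"
    and v: "v \<in> borel_measurable lebesgue"
    and u: "\<And>X t. u (X, t) = v X"
  shows "carre_evol (mat 1) 0 s u (X, t) = carre s v X"
proof -
  \<comment> \<open>Tonelli is applied to Borel functions, so \<open>v\<close> is replaced by an
    almost everywhere equal \<open>v'\<close> under the integrals, while the value
    \<open>v X\<close> at the base point is retained. Integrals over \<open>lebesgue\<close>, the
    completion of \<open>lborel\<close>, equal those over \<open>lborel\<close>.\<close>
  obtain v' where [measurable]: "v' \<in> borel_measurable borel" and v': "AE Y in lborel. v Y = v' Y"
    using completion_ex_borel_measurable_real[OF v] by auto
  have "(\<integral>\<^sup>+ Y. ennreal (p_kernel (mat 1) 0 X Y \<tau>) * ennreal ((v Y - v X)\<^sup>2) \<partial>lborel) =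
      (\<integral>\<^sup>+ Y. ennreal (p_kernel (mat 1) 0 X Y \<tau>) * ennreal ((v' Y - v X)\<^sup>2) \<partial>lborel)" for \<tau>
    by (rule nn_integral_cong_AE) (use v' in eventually_elim, simp)
  moreover have
    "(\<integral>\<^sup>+ Y. ennreal ((v X - v Y)\<^sup>2 / norm (X - Y) powr (real CARD('n) + 2 * s)) \<partial>lborel) =
     (\<integral>\<^sup>+ Y. ennreal ((v X - v' Y)\<^sup>2 / norm (X - Y) powr (real CARD('n) + 2 * s)) \<partial>lborel)"
    by (rule nn_integral_cong_AE) (use v' in eventually_elim, simp)
  ultimately show ?thesis
    using carre_evol_heat_borel[OF s, of v' X "v X"]
    by (simp add: carre_evol_def carre_def P_semigroup_def nn_integral_completion u)
qed

theorem proposition1p5: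
  fixes Q B :: "real ^ 'n ^ 'n"
    and s :: real
    and u :: "(real ^ 'n) \<times> real \<Rightarrow> real"
    and v :: "real ^ 'n \<Rightarrow> real"
  assumes "CARD('n) \<ge> 2"
    and "0 < s" and "s < 1"
    and "Q = mat 1" and "B = 0"
    and "v \<in> borel_measurable lebesgue"
    and "\<And>X t. u (X, t) = v X"
  shows "(\<forall>w. K_op Q B w = (\<lambda>z. laplacian_X w z - partial_t w z)) \<and>
    (\<forall>X t. carre_evol Q B s u (X, t) = carre s v X \<and>
      carre s v X = ennreal (gamma_const CARD('n) s / 2) *
        (\<integral>\<^sup>+ Y. ennreal ((v X - v Y)\<^sup>2 / norm (X - Y) powr (real CARD('n) + 2 * s)) \<partial>lebesgue))"
  unfolding \<open>Q = mat 1\<close> \<open>B = 0\<close>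
proof (intro conjI allI)
  show "carre_evol (mat 1) 0 s u (X, t) = carre s v X" for X t
    by (rule carre_evol_heat) (use assms in auto)
qed (rule K_op_heat carre_def)+

end
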